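(* Let $y_0,y_1,\dots,y_N$ be random vectors in $\mathbb{R}^{n_y}$ on a common probability space with $y_k\sim\mathrm{GMM}(\alpha_i,\mu_k^i,\Sigma_k^i)_{i=1:K}$ for each $k$. Let $a_j\in\mathbb{R}^{n_y}$, $b_j\in\mathbb{R}$ for $j=1,\dots,N_c$, let $G$ be a real matrix with $n_y$ columns, $g$ a real vector of compatible size, $y_{\max}\in\mathbb{R}$, and $\Delta,\Gamma\in[0,0.5]$. (a) If there are numbers $\delta_{ijk}\in(0,1)$ ($i=1,\dots,K$, $j=1,\dots,N_c$, $k=1,\dots,N$) such that $$a_j^\top\mu_k^i+F_{\mathcal N}^{-1}(1-\delta_{ijk})\,\big\|a_j^\top(\Sigma_k^i)^{\frac12}\big\|\le b_j\quad\text{for all }(i,j,k),\qquad \sum_{i=1}^K\sum_{j=1}^{N_c}\sum_{k=1}^N\alpha_i\delta_{ijk}\le\Delta,$$ then the affine joint chance constraint $$\mathbb{P}\big[a_j^\top y_k-b_j\le0\ \text{ for all } j=1,\dots,N_c,\ k=1,\dots,N\big]\ge1-\Delta$$ holds. (b) If there are numbers $\gamma_{ik}\in(0,1)$ ($i=1,\dots,K$, $k=0,\dots,N-1$) such that $$\|G\mu_k^i+g\|+\sqrt{F_{\chi^2_{n_y}}^{-1}(1-\gamma_{ik})}\;\big\|G(\Sigma_k^i)^{\frac12}\big\|\le y_{\max}\quad\text{for all }(i,k),\qquad \sum_{i=1}^K\sum_{k=0}^{N-1}\alpha_i\gamma_{ik}\le\Gamma,$$ then the 2-norm joint chance constraint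 $$\mathbb{P}\big[\|Gy_k+g\|\le y_{\max}\ \text{ for all } k=0,\dots,N-1\big]\ge1-\Gamma$$ holds.
   Context: For weights $\alpha_i\ge0$ with $\sum_{i=1}^K\alpha_i=1$, $y\sim\mathrm{GMM}(\alpha_i,\mu_i,\Sigma_i)_{i=1:K}$ means that the law of $y$ is $\sum_{i=1}^K\alpha_i\,\mathcal N(\mu_i,\Sigma_i)$, where $\mathcal N(\mu,\Sigma)$ is the (possibly degenerate, $\Sigma\succeq0$) Gaussian law. For a positive semidefinite $n_y\times n_y$ matrix $\Sigma$, $\Sigma^{\frac12}$ denotes an $n_y\times n_y$ matrix with $\Sigma^{\frac12}(\Sigma^{\frac12})^\top=\Sigma$. $\|\cdot\|$ is the Euclidean norm of a vector and the spectral norm of a matrix. $F_{\mathcal N}^{-1}$ is the inverse cumulative distribution function of the standard normal distribution, and $F_{\chi^2_{n_y}}^{-1}$ is the inverse cumulative distribution function of the chi-squared distribution with $n_y$ degrees of freedom. *)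

theory Defs
  imports "HOL-Probability.Probability"
begin

definition psd :: "real^'n^'n \<Rightarrow> bool" where
  "psd \<Sigma> \<longleftrightarrow> transpose \<Sigma> = \<Sigma> \<and> (\<forall>x. 0 \<le> x \<bullet> (\<Sigma> *v x))"

(* Not necessarily symmetric: any factor S with S S^T = \<Sigma>, e.g. a Cholesky factor. *)
definition is_matrix_sqrt :: "real^'n^'n \<Rightarrow> real^'n^'n \<Rightarrow> bool" where
  "is_matrix_sqrt S \<Sigma> \<longleftrightarrow> S ** transpose S = \<Sigma>"

definition spectral_norm :: "real^'n^'m \<Rightarrow> real" where
  "spectral_norm A = onorm (\<lambda>x. A *v x)"

definition std_gaussian :: "(real^'n) measure" where
  "std_gaussian = distr (\<Pi>\<^sub>M i\<in>UNIV. std_normal_distribution) borel (\<lambda>z. \<chi> i. z i)"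

(* The law of \<mu> + A z for a standard Gaussian z and A A^T = \<Sigma>.  It is defined for singular \<Sigma> too.
   By rotation invariance of the standard Gaussian it does not depend on which A is picked.
   Meaningful only for psd \<Sigma>: otherwise no such A exists. *)
definition gaussian :: "real^'n \<Rightarrow> real^'n^'n \<Rightarrow> (real^'n) measure" where
  "gaussian \<mu> \<Sigma> = distr std_gaussian borel (\<lambda>z. \<mu> + (SOME A. is_matrix_sqrt A \<Sigma>) *v z)"

definition gmm ::
  "nat \<Rightarrow> (nat \<Rightarrow> real) \<Rightarrow> (nat \<Rightarrow> real^'n) \<Rightarrow> (nat \<Rightarrow> real^'n^'n) \<Rightarrow> (real^'n) measure" where
  "gmm K \<alpha> \<mu> \<Sigma> = measure_of UNIV (sets borel)
     (\<lambda>B. \<Sum>i=1..K. ennreal (\<alpha> i) * emeasure (gaussian (\<mu> i) (\<Sigma> i)) B)"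

(* Law of the sum of squares of n independent standard normal variables. *)
definition chi_square_distribution :: "nat \<Rightarrow> real measure" where
  "chi_square_distribution n =
     distr (\<Pi>\<^sub>M i\<in>{..<n}. std_normal_distribution) borel (\<lambda>z. \<Sum>i<n. (z i)\<^sup>2)"

(* For 0 < p < 1 and a cdf that is continuous and strictly increasing where it lies in (0,1), as for
   the two laws it is applied to, this is the unique x with cdf M x = p. *)
definition inv_cdf :: "real measure \<Rightarrow> real \<Rightarrow> real" where
  "inv_cdf M p = Inf {x. p \<le> cdf M x}"

lemma sets_gmm [simp]: "sets (gmm K \<alpha> \<mu> \<Sigma>) = sets borel"
  using sets.sigma_sets_eq[of borel] by (simp add: gmm_def)

lemma space_gmm [simp]: "space (gmm K \<alpha> \<mu> \<Sigma>) = UNIV"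
  by (simp add: gmm_def space_measure_of_conv)

lemma emeasure_gmm:
  fixes B :: "(real^'n) set"
  assumes "B \<in> sets borel"
  shows "emeasure (gmm K \<alpha> \<mu> \<Sigma>) B =
    (\<Sum>i=1..K. ennreal (\<alpha> i) * emeasure (gaussian (\<mu> i) (\<Sigma> i)) B)"
proof (rule emeasure_measure_of[OF gmm_def])
  let ?f = "\<lambda>B. \<Sum>i=1..K. ennreal (\<alpha> i) * emeasure (gaussian (\<mu> i) (\<Sigma> i)) B"
  show "positive (sets (gmm K \<alpha> \<mu> \<Sigma>)) ?f"
    by (simp add: positive_def)
  show "countably_additive (sets (gmm K \<alpha> \<mu> \<Sigma>)) ?f"
  proof (rule countably_additiveI)
    fix A :: "nat \<Rightarrow> (real^'n) set"
    assume A: "range A \<subseteq> sets (gmm K \<alpha> \<mu> \<Sigma>)" "disjoint_family A"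
    then have "range A \<subseteq> sets (gaussian (\<mu> i) (\<Sigma> i))" for i
      by (simp add: gaussian_def)
    then show "(\<Sum>n. ?f (A n)) = ?f (\<Union>n. A n)"
      using A by (simp add: suminf_sum suminf_emeasure)
  qed
qed (use assms in auto)

end

theory Submission
  imports Defs
begin

text \<open>
  A Gaussian component is the law of $\mu + A z$ with $A A^\top = S S^\top$, so $\|A^\top v\| = \|S^\top v\|$
  for every $v$.  Hence $a^\top A z$ is centred normal with standard deviation $\|a^\top S\|$, and
  $\|G A z\| \le \|G S\| \|z\|$, where $\|z\|^2$ is chi-squared distributed.  The hypotheses thus bound the
  probability of violation under each component by $\delta_{ijk}$ or $\gamma_{ik}$.  Averaging
  over the mixture and the union bound over the constraints give the claim.
\<close>

section \<open>Quantiles of real distributions\<close>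

lemma (in real_distribution) le_cdf_inv_cdf:
  assumes "0 < p" "p < 1"
  shows "p \<le> cdf M (inv_cdf M p)"
proof -
  let ?X = "{x. p \<le> cdf M x}"
  \<comment> \<open>Since the cdf tends to 1 and \<open>p < 1\<close>, the set \<open>?X\<close> is
    nonempty, so every point above its infimum lies above some element of it.\<close>
  obtain x0 where "p < cdf M x0"
    using order_tendstoD(1)[OF cdf_lim_at_top_prob assms(2)] by (auto simp: eventually_at_top_linorder)
  then have ne: "?X \<noteq> {}"
    by (auto intro: less_imp_le)
  have above: "p \<le> cdf M x" if x: "inv_cdf M p < x" for x
  proof -
    obtain u where "u \<in> ?X" "u < x"
      using cInf_lessD[OF ne] x unfolding inv_cdf_def by blast
    then show ?thesis
      using cdf_nondecreasing[of u x] by auto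
  qed
  show ?thesis
  \<comment> \<open>The bound holds at every point to the right of the quantile; right-continuity of
    the cdf carries it to the quantile itself.\<close>
  proof (rule tendsto_lowerbound)
    show "(cdf M \<longlongrightarrow> cdf M (inv_cdf M p)) (at_right (inv_cdf M p))"
      using cdf_is_right_cont by (simp add: continuous_within)
    show "\<forall>\<^sub>F x in at_right (inv_cdf M p). p \<le> cdf M x"
      using above by (auto simp: eventually_at_right_less intro: eventually_mono[OF eventually_at_right_less])
  qed simp
qed

section \<open>The standard Gaussian vector: linear forms and the squared norm\<close>

lemma prob_space_std_normal: "prob_space std_normal_distribution"
  using real_dist_normal_dist by (simp add: real_distribution_def)

lemma measurable_vec_lambda_std_normal [measurable]:
  "(\<lambda>z. \<chi> i. z i) \<in> measurable (\<Pi>\<^sub>M i\<in>(UNIV::'n::finite set). std_normal_distribution) (borel :: (real^'n) measure)"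
  unfolding borel_measurable_euclidean_space[where 'c="real^'n"]
  by (auto simp: Basis_vec_def inner_axis)

lemma prob_space_std_gaussian: "prob_space (std_gaussian :: (real^'n) measure)"
  unfolding std_gaussian_def
  by (intro prob_space.prob_space_distr prob_space_PiM prob_space_std_normal measurable_vec_lambda_std_normal)

lemma sets_std_gaussian [simp, measurable_cong]: "sets std_gaussian = sets borel"
  by (simp add: std_gaussian_def)

lemma space_std_gaussian [simp]: "space std_gaussian = UNIV"
  by (simp add: std_gaussian_def)

text \<open>The terms \<open>c $ i * z i\<close> are independent centred normals with standard
  deviations \<open>\<bar>c $ i\<bar>\<close>, so their sum is normal and the variances add up to
  the square of \<open>norm c\<close>.\<close>

lemma distributed_std_gaussian_inner:
  fixes c :: "real^'n"
  assumes "c \<noteq> 0"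
  shows "distributed std_gaussian lborel (\<lambda>z. c \<bullet> z) (normal_density 0 (norm c))"
proof -
  let ?P = "\<Pi>\<^sub>M i\<in>(UNIV::'n set). std_normal_distribution"
  \<comment> \<open>A term with \<open>c $ i = 0\<close> is constant and has no density, so the
    normal sum runs over the support of \<open>c\<close> only. Neither the inner product nor the
    norm changes.\<close>
  let ?I = "{i. c $ i \<noteq> 0}"
  interpret P: prob_space ?P
    by (intro prob_space_PiM prob_space_std_normal)
  have std: "distributed ?P lborel (\<lambda>z. z i) std_normal_density" for i
  proof -
    \<comment> \<open>\<open>distr\<close> sees only the sigma-algebra of its target, so
      \<open>lborel\<close> can be exchanged for the factor measure that the projection lemma
      expects.\<close>
    have "distr ?P lborel (\<lambda>z. z i) = distr ?P std_normal_distribution (\<lambda>z. z i)"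
      by (rule distr_cong) auto
    also have "\<dots> = std_normal_distribution"
      by (intro distr_PiM_component prob_space_std_normal) auto
    finally show ?thesis
      by (simp add: distributed_def)
  qed
  have "distributed ?P lborel (\<lambda>z. 0 + c $ i * z i) (normal_density (0 + c $ i * 0) (\<bar>c $ i\<bar> * 1))"
    if "i \<in> ?I" for i
    using that by (intro P.normal_density_affine std) auto
  then have comp: "distributed ?P lborel (\<lambda>z. c $ i * z i) (normal_density 0 \<bar>c $ i\<bar>)"
    if "i \<in> ?I" for i
    using that by simp
  \<comment> \<open>Independence is equality of the joint law with the product of the marginals;
    here the joint map is the identity on the product space.\<close>
  have indep0: "P.indep_vars (\<lambda>i. std_normal_distribution) (\<lambda>i z. z i) UNIV"
    by (subst P.indep_vars_iff_distr_eq_PiM')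
      (auto simp: distr_PiM_component[OF prob_space_std_normal] restrict_UNIV)
  have "P.indep_vars (\<lambda>i. borel) (\<lambda>i z. c $ i * z i) UNIV"
    by (rule P.indep_vars_compose2[OF indep0, where Y="\<lambda>i x. c $ i * x"]) auto
  then have indep: "P.indep_vars (\<lambda>i. borel) (\<lambda>i z. c $ i * z i) ?I"
    by (rule P.indep_vars_subset) auto
  have "?I \<noteq> {}"
    using assms by (auto simp: vec_eq_iff)
  then have "distributed ?P lborel (\<lambda>z. \<Sum>i\<in>?I. c $ i * z i)
      (normal_density (\<Sum>i\<in>?I. 0) (sqrt (\<Sum>i\<in>?I. \<bar>c $ i\<bar>\<^sup>2)))"
    by (intro P.sum_indep_normal indep comp) auto
  moreover have "(\<Sum>i\<in>?I. c $ i * z i) = c \<bullet> (\<chi> i. z i)" for z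
    by (auto simp: inner_vec_def intro!: sum.mono_neutral_left)
  moreover have "sqrt (\<Sum>i\<in>?I. \<bar>c $ i\<bar>\<^sup>2) = norm c"
    by (auto simp: norm_vec_def L2_set_def intro!: arg_cong[where f=sqrt] sum.mono_neutral_left)
  ultimately have "distr ?P lborel (\<lambda>z. c \<bullet> (\<chi> i. z i)) = density lborel (normal_density 0 (norm c))"
    by (simp add: distributed_def)
  moreover have "distr ?P lborel (\<lambda>z. c \<bullet> (\<chi> i. z i)) = distr std_gaussian lborel (\<lambda>z. c \<bullet> z)"
    unfolding std_gaussian_def by (subst distr_distr) (auto simp: comp_def)
  ultimately show ?thesis
    by (simp add: distributed_def)
qed

text \<open>Dividing by \<open>norm c\<close> turns the linear form into a standard normal variable,
  and the halfspace into the event that this variable is at most its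
  \<open>p\<close>-quantile.\<close>

lemma std_gaussian_halfspace:
  fixes c :: "real^'n"
  assumes "0 < p" "p < 1"
  shows "p \<le> measure std_gaussian {z. c \<bullet> z \<le> inv_cdf std_normal_distribution p * norm c}"
proof (cases "c = 0")
  \<comment> \<open>This is the case of a direction without variance: both sides of the inequality
    are 0 and the set is the whole space.\<close>
  case True
  then show ?thesis
    using assms prob_space.prob_space[OF prob_space_std_gaussian[where 'n='n]] by simp
next
  case False
  interpret prob_space "std_gaussian :: (real^'n) measure"
    by (rule prob_space_std_gaussian)
  let ?q = "inv_cdf std_normal_distribution p"
  have pos: "0 < norm c"
    using False by simp
  have "distributed std_gaussian lborel (\<lambda>z. (c \<bullet> z - 0) / norm c) std_normal_density"
    using distributed_std_gaussian_inner[OF False] normal_standard_normal_convert[OF pos] by blast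
  then have std: "std_normal_distribution = distr std_gaussian lborel (\<lambda>z. c \<bullet> z / norm c)"
    by (simp add: distributed_def)
  have "p \<le> cdf std_normal_distribution ?q"
    by (rule real_distribution.le_cdf_inv_cdf[OF real_dist_normal_dist assms])
  also have "cdf std_normal_distribution ?q =
      measure (distr std_gaussian lborel (\<lambda>z. c \<bullet> z / norm c)) {..?q}"
    by (simp only: cdf_def2 flip: std)
  also have "\<dots> = measure std_gaussian {z. c \<bullet> z \<le> ?q * norm c}"
    using pos by (subst measure_distr) (auto simp: vimage_def divide_le_eq)
  finally show ?thesis .
qed

text \<open>The two laws differ in their index sets: the coordinates are indexed by the type
  \<open>'n\<close>, the chi-squared law by the numbers below \<open>CARD('n)\<close>. An
  enumeration \<open>f\<close> of the type carries one product measure to the other.\<close>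

lemma std_gaussian_norm_square:
  "distr (std_gaussian :: (real^'n) measure) borel (\<lambda>z. (norm z)\<^sup>2) = chi_square_distribution CARD('n)"
proof -
  let ?P = "\<Pi>\<^sub>M i\<in>(UNIV::'n set). std_normal_distribution"
  let ?Q = "\<Pi>\<^sub>M i\<in>{..<CARD('n)}. std_normal_distribution"
  obtain f :: "nat \<Rightarrow> 'n" where f: "bij_betw f {..<CARD('n)} UNIV"
    using ex_bij_betw_nat_finite[of "UNIV :: 'n set"] by (auto simp: atLeast0LessThan)
  have Q: "distr ?P ?Q (\<lambda>z. \<lambda>n\<in>{..<CARD('n)}. z (f n)) = ?Q"
    using f by (intro distr_PiM_reindex prob_space_std_normal) (auto simp: bij_betw_def)
  have meas: "(\<lambda>z. \<lambda>n\<in>{..<CARD('n)}. z (f n)) \<in> measurable ?P ?Q"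
    by (rule measurable_restrict) auto
  have "chi_square_distribution CARD('n) =
      distr (distr ?P ?Q (\<lambda>z. \<lambda>n\<in>{..<CARD('n)}. z (f n))) borel (\<lambda>z. \<Sum>i<CARD('n). (z i)\<^sup>2)"
    by (simp only: chi_square_distribution_def Q)
  also have "\<dots> = distr ?P borel (\<lambda>z. \<Sum>i<CARD('n). (z (f i))\<^sup>2)"
    using meas by (subst distr_distr) (auto simp: comp_def)
  also have "(\<lambda>z :: 'n \<Rightarrow> real. \<Sum>i<CARD('n). (z (f i))\<^sup>2) = (\<lambda>z. (norm (\<chi> i. z i))\<^sup>2)"
    using sum.reindex_bij_betw[OF f]
    by (auto simp: fun_eq_iff norm_vec_def L2_set_def sum_nonneg)
  also have "distr ?P borel \<dots> = distr (std_gaussian :: (real^'n) measure) borel (\<lambda>z. (norm z)\<^sup>2)"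
    unfolding std_gaussian_def by (subst distr_distr) (auto simp: comp_def)
  finally show ?thesis ..
qed

lemma std_gaussian_ball:
  assumes "0 < p" "p < 1"
  shows "p \<le> measure std_gaussian {z :: real^'n. norm z \<le> sqrt (inv_cdf (chi_square_distribution CARD('n)) p)}"
proof -
  interpret prob_space "std_gaussian :: (real^'n) measure"
    by (rule prob_space_std_gaussian)
  let ?q = "inv_cdf (chi_square_distribution CARD('n)) p"
  have "real_distribution (chi_square_distribution CARD('n))"
    unfolding std_gaussian_norm_square[symmetric] by (rule real_distribution_distr) simp
  then have "p \<le> cdf (chi_square_distribution CARD('n)) ?q"
    using assms by (rule real_distribution.le_cdf_inv_cdf)
  also have "\<dots> = measure (distr (std_gaussian :: (real^'n) measure) borel (\<lambda>z. (norm z)\<^sup>2)) {..?q}"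
    by (simp only: cdf_def2 std_gaussian_norm_square)
  also have "\<dots> = measure std_gaussian {z :: real^'n. (norm z)\<^sup>2 \<le> ?q}"
    by (subst measure_distr) (auto simp: vimage_def)
  \<comment> \<open>The inclusion holds for either sign of \<open>?q\<close>: a square below
    \<open>?q\<close> forces \<open>?q\<close> to be nonnegative, and for negative \<open>?q\<close>
    the left set is empty.\<close>
  also have "\<dots> \<le> measure std_gaussian {z :: real^'n. norm z \<le> sqrt ?q}"
    by (intro finite_measure_mono) (auto intro: real_le_rsqrt)
  finally show ?thesis .
qed

section \<open>Independence of the chosen matrix factor\<close>

lemma measurable_matrix_vector_mult [measurable]:
  "(\<lambda>z. (A :: real^'n^'m) *v z) \<in> borel_measurable borel"
  by (intro borel_measurable_continuous_onI continuous_intros)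

text \<open>Isolates the choice operator in \<open>gaussian\<close>. The given \<open>S\<close> only
  witnesses that a factor exists; the chosen \<open>A\<close> may be a different one, and
  \<open>A ** transpose A = \<Sigma>\<close> is all that later arguments know of it.\<close>

lemma measure_gaussian_obtain:
  fixes \<Sigma> :: "real^'n^'n"
  assumes "is_matrix_sqrt S \<Sigma>"
  obtains A where "is_matrix_sqrt A \<Sigma>"
    "\<And>\<mu> C. C \<in> sets borel \<Longrightarrow> measure (gaussian \<mu> \<Sigma>) C = measure std_gaussian {z. \<mu> + A *v z \<in> C}"
proof
  show "is_matrix_sqrt (SOME A. is_matrix_sqrt A \<Sigma>) \<Sigma>"
    using assms by (rule someI)
  show "measure (gaussian \<mu> \<Sigma>) C = measure std_gaussian {z. \<mu> + (SOME A. is_matrix_sqrt A \<Sigma>) *v z \<in> C}"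
    if "C \<in> sets borel" for \<mu> C
    using that unfolding gaussian_def by (subst measure_distr) (auto simp: vimage_def)
qed

lemma norm_vector_matrix_square:
  fixes A :: "real^'n^'m"
  shows "(norm (v v* A))\<^sup>2 = v \<bullet> ((A ** transpose A) *v v)"
  by (simp add: power2_norm_eq_inner dot_lmul_matrix matrix_vector_mul_assoc[symmetric])

text \<open>Both norms are the square root of the quadratic form of \<open>\<Sigma>\<close> at
  \<open>v\<close>. This takes the place of rotation invariance when the factor inside
  \<open>gaussian\<close> is traded for the one in the hypotheses.\<close>

lemma norm_vector_matrix_sqrt:
  assumes "is_matrix_sqrt A \<Sigma>" "is_matrix_sqrt S \<Sigma>"
  shows "norm (v v* A) = norm (v v* S)"
proof -
  have "(norm (v v* A))\<^sup>2 = (norm (v v* S))\<^sup>2"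
    using assms by (simp only: norm_vector_matrix_square is_matrix_sqrt_def)
  then show ?thesis
    by simp
qed

lemma spectral_norm_nonneg: "0 \<le> spectral_norm A"
  unfolding spectral_norm_def by (rule onorm_pos_le) (rule matrix_vector_mul_bounded_linear)

lemma norm_matrix_vector_le: "norm (A *v x) \<le> spectral_norm A * norm x"
  unfolding spectral_norm_def by (rule onorm) (rule matrix_vector_mul_bounded_linear)

text \<open>The transpose has no larger operator norm: with \<open>w = x v* A\<close>, the square of
  \<open>norm w\<close> is the inner product of \<open>x\<close> and \<open>A *v w\<close>, hence at
  most \<open>norm x * spectral_norm A * norm w\<close>, and one factor \<open>norm w\<close>
  cancels.\<close>

lemma norm_vector_matrix_le: "norm (x v* A) \<le> spectral_norm A * norm x"
proof (cases "norm (x v* A) = 0")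
  case True
  then show ?thesis
    by (simp add: spectral_norm_nonneg)
next
  case False
  have "norm (x v* A) * norm (x v* A) = x \<bullet> (A *v (x v* A))"
    by (simp add: dot_lmul_matrix[symmetric] power2_norm_eq_inner[symmetric] power2_eq_square)
  also have "\<dots> \<le> norm x * norm (A *v (x v* A))"
    by (rule norm_cauchy_schwarz)
  also have "\<dots> \<le> norm x * (spectral_norm A * norm (x v* A))"
    by (intro mult_left_mono norm_matrix_vector_le) simp
  finally have "norm (x v* A) * norm (x v* A) \<le> (spectral_norm A * norm x) * norm (x v* A)"
    by (simp add: ac_simps)
  then show ?thesis
    using False by (simp add: mult_le_cancel_right)
qed

text \<open>The factors \<open>A\<close> and \<open>S\<close> can be compared only when multiplied
  by a row vector from the left. Pairing \<open>G *v (A *v z)\<close> with itself produces such a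
  row, and one factor of the norm cancels at the end.\<close>

lemma norm_matrix_sqrt_le:
  assumes "is_matrix_sqrt A \<Sigma>" "is_matrix_sqrt S \<Sigma>"
  shows "norm (G *v (A *v z)) \<le> spectral_norm (G ** S) * norm z"
proof (cases "norm (G *v (A *v z)) = 0")
  case True
  then show ?thesis
    by (simp add: spectral_norm_nonneg)
next
  case False
  let ?w = "G *v (A *v z)"
  have "norm ?w * norm ?w = ?w \<bullet> (G *v (A *v z))"
    by (simp add: power2_norm_eq_inner[symmetric] power2_eq_square)
  also have "\<dots> = ((?w v* G) v* A) \<bullet> z"
    by (simp only: dot_lmul_matrix)
  also have "\<dots> \<le> norm ((?w v* G) v* A) * norm z"
    by (rule norm_cauchy_schwarz)
  \<comment> \<open>Here \<open>A\<close> is traded for \<open>S\<close>, with the row vector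
    \<open>?w v* G\<close>.\<close>
  also have "norm ((?w v* G) v* A) = norm (?w v* (G ** S))"
    by (simp only: vector_matrix_mul_assoc[symmetric] norm_vector_matrix_sqrt[OF assms])
  also have "norm (?w v* (G ** S)) * norm z \<le> spectral_norm (G ** S) * norm ?w * norm z"
    by (intro mult_right_mono norm_vector_matrix_le) simp
  finally have "norm ?w * norm ?w \<le> (spectral_norm (G ** S) * norm z) * norm ?w"
    by (simp add: ac_simps)
  then show ?thesis
    using False by (simp add: mult_le_cancel_right)
qed

section \<open>Probability bounds for a single Gaussian component\<close>

lemma gaussian_halfspace:
  assumes "is_matrix_sqrt S \<Sigma>" "0 < p" "p < 1"
    and "a \<bullet> \<mu> + inv_cdf std_normal_distribution p * norm (a v* S) \<le> b"
  shows "p \<le> measure (gaussian \<mu> \<Sigma>) {x. a \<bullet> x \<le> b}"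
proof -
  obtain A where A: "is_matrix_sqrt A \<Sigma>"
    and meas: "\<And>\<mu> C. C \<in> sets borel \<Longrightarrow> measure (gaussian \<mu> \<Sigma>) C = measure std_gaussian {z. \<mu> + A *v z \<in> C}"
    by (rule measure_gaussian_obtain[OF assms(1)]) blast
  have "p \<le> measure std_gaussian {z. (a v* A) \<bullet> z \<le> inv_cdf std_normal_distribution p * norm (a v* A)}"
    using assms(2,3) by (rule std_gaussian_halfspace)
  \<comment> \<open>By the hypothesis, what the mean leaves of \<open>b\<close> is at least the
    quantile times \<open>norm (a v* S)\<close>, which equals \<open>norm (a v* A)\<close>.\<close>
  also have "\<dots> \<le> measure std_gaussian {z. a \<bullet> (\<mu> + A *v z) \<le> b}"
    using assms(4)
    by (intro finite_measure.finite_measure_mono prob_space.finite_measure prob_space_std_gaussian)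
      (auto simp: norm_vector_matrix_sqrt[OF A assms(1)] dot_lmul_matrix inner_add_right)
  finally show ?thesis
    by (simp add: meas)
qed

text \<open>The affine map carries the ball that \<open>z\<close> hits with probability at least
  \<open>p\<close> into the target ball. This is an inclusion of events, generally strict, so the
  condition on \<open>r\<close> is only sufficient.\<close>

lemma gaussian_norm_affine:
  fixes G :: "real^'n^'m"
  assumes "is_matrix_sqrt S \<Sigma>" "0 < p" "p < 1"
    and "norm (G *v \<mu> + g)
      + sqrt (inv_cdf (chi_square_distribution CARD('n)) p) * spectral_norm (G ** S) \<le> r"
  shows "p \<le> measure (gaussian \<mu> \<Sigma>) {x. norm (G *v x + g) \<le> r}"
proof -
  let ?q = "sqrt (inv_cdf (chi_square_distribution CARD('n)) p)"
  obtain A where A: "is_matrix_sqrt A \<Sigma>"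
    and meas: "\<And>\<mu> C. C \<in> sets borel \<Longrightarrow> measure (gaussian \<mu> \<Sigma>) C = measure std_gaussian {z. \<mu> + A *v z \<in> C}"
    by (rule measure_gaussian_obtain[OF assms(1)]) blast
  have "norm (G *v (\<mu> + A *v z) + g) \<le> r" if "norm z \<le> ?q" for z :: "real^'n"
  proof -
    have "norm (G *v (\<mu> + A *v z) + g) \<le> norm (G *v \<mu> + g) + norm (G *v (A *v z))"
      using norm_triangle_ineq[of "G *v \<mu> + g" "G *v (A *v z)"]
      by (simp add: matrix_vector_right_distrib algebra_simps)
    also have "norm (G *v (A *v z)) \<le> spectral_norm (G ** S) * norm z"
      by (rule norm_matrix_sqrt_le[OF A assms(1)])
    also have "\<dots> \<le> ?q * spectral_norm (G ** S)"
      using mult_left_mono[OF that spectral_norm_nonneg[of "G ** S"]] by (simp add: ac_simps)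
    finally show ?thesis
      using assms(4) by simp
  qed
  then have "measure std_gaussian {z :: real^'n. norm z \<le> ?q}
      \<le> measure std_gaussian {z. norm (G *v (\<mu> + A *v z) + g) \<le> r}"
    by (intro finite_measure.finite_measure_mono prob_space.finite_measure prob_space_std_gaussian) auto
  with std_gaussian_ball[OF assms(2,3), where 'n='n] show ?thesis
    by (simp add: meas)
qed

section \<open>Gaussian mixtures and the union bound\<close>

lemma prob_space_gaussian: "prob_space (gaussian \<mu> \<Sigma>)"
  unfolding gaussian_def by (rule prob_space.prob_space_distr[OF prob_space_std_gaussian]) simp

text \<open>Passes from extended nonnegative reals to reals. The sign of the weights matters, since
  \<open>ennreal\<close> sends negative numbers to 0.\<close>

lemma measure_gmm:
  assumes "C \<in> sets borel" "\<And>i. i \<in> {1..K} \<Longrightarrow> 0 \<le> \<alpha> i"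
  shows "measure (gmm K \<alpha> \<mu> \<Sigma>) C = (\<Sum>i=1..K. \<alpha> i * measure (gaussian (\<mu> i) (\<Sigma> i)) C)"
proof -
  have "emeasure (gmm K \<alpha> \<mu> \<Sigma>) C = (\<Sum>i=1..K. ennreal (\<alpha> i) * ennreal (measure (gaussian (\<mu> i) (\<Sigma> i)) C))"
    using assms(1)
    by (simp add: emeasure_gmm
        finite_measure.emeasure_eq_measure[OF prob_space.finite_measure[OF prob_space_gaussian]])
  also have "\<dots> = ennreal (\<Sum>i=1..K. \<alpha> i * measure (gaussian (\<mu> i) (\<Sigma> i)) C)"
    using assms(2) by (subst sum_ennreal[symmetric]) (auto simp: ennreal_mult')
  finally show ?thesis
    using assms(2) by (intro measure_eq_emeasure_eq_ennreal) (auto intro: sum_nonneg)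
qed

text \<open>The common core of both claims, with an abstract index set \<open>J\<close> of
  constraints. The union bound uses only the law of each single \<open>Y j\<close>, so the
  dependence between different times is arbitrary.\<close>

lemma (in prob_space) gmm_joint_chance:
  fixes Y :: "'j \<Rightarrow> 'a \<Rightarrow> real^'n"
  assumes J: "finite J"
    and \<alpha>: "\<And>i. i \<in> {1..K} \<Longrightarrow> 0 \<le> \<alpha> i" "(\<Sum>i=1..K. \<alpha> i) = 1"
    and Y: "\<And>j. j \<in> J \<Longrightarrow> Y j \<in> borel_measurable M"
    and law: "\<And>j. j \<in> J \<Longrightarrow> distr M borel (Y j) = gmm K \<alpha> (\<mu> j) (\<Sigma> j)"
    and C: "\<And>j. j \<in> J \<Longrightarrow> C j \<in> sets borel"
    and comp: "\<And>i j. i \<in> {1..K} \<Longrightarrow> j \<in> J \<Longrightarrow> 1 - \<epsilon> i j \<le> measure (gaussian (\<mu> j i) (\<Sigma> j i)) (C j)"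
  shows "1 - (\<Sum>i=1..K. \<Sum>j\<in>J. \<alpha> i * \<epsilon> i j) \<le> prob {\<omega> \<in> space M. \<forall>j\<in>J. Y j \<omega> \<in> C j}"
proof -
  let ?good = "\<lambda>j. Y j -` C j \<inter> space M"
  have good: "?good j \<in> events" if "j \<in> J" for j
    using Y C that by (auto intro: measurable_sets)
  have bad: "prob (space M - ?good j) \<le> (\<Sum>i=1..K. \<alpha> i * \<epsilon> i j)" if j: "j \<in> J" for j
  proof -
    \<comment> \<open>As the weights sum to 1, the leading 1 can be distributed over the
      components.\<close>
    have "1 - (\<Sum>i=1..K. \<alpha> i * \<epsilon> i j) = (\<Sum>i=1..K. \<alpha> i * (1 - \<epsilon> i j))"
      using \<alpha>(2) by (simp add: right_diff_distrib sum_subtractf)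
    also have "\<dots> \<le> (\<Sum>i=1..K. \<alpha> i * measure (gaussian (\<mu> j i) (\<Sigma> j i)) (C j))"
      by (intro sum_mono mult_left_mono comp \<alpha>(1) j)
    also have "\<dots> = measure (distr M borel (Y j)) (C j)"
      using measure_gmm[OF C[OF j] \<alpha>(1)] law[OF j] by simp
    also have "\<dots> = prob (?good j)"
      by (rule measure_distr[OF Y[OF j] C[OF j]])
    finally show ?thesis
      using prob_compl[OF good[OF j]] by simp
  qed
  have "prob (\<Union>j\<in>J. space M - ?good j) \<le> (\<Sum>j\<in>J. prob (space M - ?good j))"
    using J good by (intro finite_measure_subadditive_finite) auto
  also have "\<dots> \<le> (\<Sum>j\<in>J. \<Sum>i=1..K. \<alpha> i * \<epsilon> i j)"
    by (intro sum_mono bad)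
  also have "\<dots> = (\<Sum>i=1..K. \<Sum>j\<in>J. \<alpha> i * \<epsilon> i j)"
    by (rule sum.swap)
  finally have "prob (\<Union>j\<in>J. space M - ?good j) \<le> (\<Sum>i=1..K. \<Sum>j\<in>J. \<alpha> i * \<epsilon> i j)" .
  moreover have "(\<Union>j\<in>J. space M - ?good j) \<in> events"
    using J good by (intro sets.finite_UN) auto
  moreover have "{\<omega> \<in> space M. \<forall>j\<in>J. Y j \<omega> \<in> C j} = space M - (\<Union>j\<in>J. space M - ?good j)"
    by auto
  ultimately show ?thesis
    using prob_compl[of "\<Union>j\<in>J. space M - ?good j"] by simp
qed

theorem theorem2:
  fixes M :: "'w measure"
    and y :: "nat \<Rightarrow> 'w \<Rightarrow> real^'n"
    and K N Nc :: nat
    and \<alpha> :: "nat \<Rightarrow> real"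
    and \<mu> :: "nat \<Rightarrow> nat \<Rightarrow> real^'n"
    and \<Sigma> S :: "nat \<Rightarrow> nat \<Rightarrow> real^'n^'n"
    and a :: "nat \<Rightarrow> real^'n"
    and b :: "nat \<Rightarrow> real"
    and G :: "real^'n^'m"
    and g :: "real^'m"
    and y_max \<Delta> \<Gamma> :: real
  assumes "prob_space M"
    and "\<And>i. i \<in> {1..K} \<Longrightarrow> 0 \<le> \<alpha> i"
    and "(\<Sum>i=1..K. \<alpha> i) = 1"
    and "\<And>k i. k \<le> N \<Longrightarrow> i \<in> {1..K} \<Longrightarrow> psd (\<Sigma> k i)"
    and "\<And>k i. k \<le> N \<Longrightarrow> i \<in> {1..K} \<Longrightarrow> is_matrix_sqrt (S k i) (\<Sigma> k i)"
    and "\<And>k. k \<le> N \<Longrightarrow> y k \<in> borel_measurable M"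
    and "\<And>k. k \<le> N \<Longrightarrow> distr M borel (y k) = gmm K \<alpha> (\<mu> k) (\<Sigma> k)"
    and "\<Delta> \<in> {0..1/2}"
    and "\<Gamma> \<in> {0..1/2}"
  shows
    "((\<exists>\<delta> :: nat \<Rightarrow> nat \<Rightarrow> nat \<Rightarrow> real.
        (\<forall>i\<in>{1..K}. \<forall>j\<in>{1..Nc}. \<forall>k\<in>{1..N}.
           \<delta> i j k \<in> {0<..<1} \<and>
           a j \<bullet> \<mu> k i + inv_cdf std_normal_distribution (1 - \<delta> i j k) * norm (a j v* S k i) \<le> b j) \<and>
        (\<Sum>i=1..K. \<Sum>j=1..Nc. \<Sum>k=1..N. \<alpha> i * \<delta> i j k) \<le> \<Delta>)
     \<longrightarrow> measure M {\<omega> \<in> space M. \<forall>j\<in>{1..Nc}. \<forall>k\<in>{1..N}. a j \<bullet> y k \<omega> - b j \<le> 0} \<ge> 1 - \<Delta>) \<and>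
     ((\<exists>\<gamma> :: nat \<Rightarrow> nat \<Rightarrow> real.
        (\<forall>i\<in>{1..K}. \<forall>k\<in>{0..<N}.
           \<gamma> i k \<in> {0<..<1} \<and>
           norm (G *v \<mu> k i + g)
             + sqrt (inv_cdf (chi_square_distribution CARD('n)) (1 - \<gamma> i k)) * spectral_norm (G ** S k i)
             \<le> y_max) \<and>
        (\<Sum>i=1..K. \<Sum>k=0..<N. \<alpha> i * \<gamma> i k) \<le> \<Gamma>)
     \<longrightarrow> measure M {\<omega> \<in> space M. \<forall>k\<in>{0..<N}. norm (G *v y k \<omega> + g) \<le> y_max} \<ge> 1 - \<Gamma>)"
proof (intro conjI impI; elim exE conjE)
  interpret prob_space M by fact
  fix \<delta> :: "nat \<Rightarrow> nat \<Rightarrow> nat \<Rightarrow> real"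
  assume \<delta>: "\<forall>i\<in>{1..K}. \<forall>j\<in>{1..Nc}. \<forall>k\<in>{1..N}.
      \<delta> i j k \<in> {0<..<1} \<and>
      a j \<bullet> \<mu> k i + inv_cdf std_normal_distribution (1 - \<delta> i j k) * norm (a j v* S k i) \<le> b j"
    and sum: "(\<Sum>i=1..K. \<Sum>j=1..Nc. \<Sum>k=1..N. \<alpha> i * \<delta> i j k) \<le> \<Delta>"
  \<comment> \<open>The constraints are indexed by pairs: the time \<open>k\<close> selects the
    random vector and its law, while \<open>j\<close> selects the halfspace. The same vector thus
    occurs under several indices, which the union bound permits.\<close>
  have "1 - (\<Sum>i=1..K. \<Sum>(j, k)\<in>{1..Nc} \<times> {1..N}. \<alpha> i * \<delta> i j k)
      \<le> prob {\<omega> \<in> space M. \<forall>jk\<in>{1..Nc} \<times> {1..N}. y (snd jk) \<omega> \<in> {x. a (fst jk) \<bullet> x \<le> b (fst jk)}}"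
    unfolding case_prod_beta
  proof (rule gmm_joint_chance[where \<mu>="\<lambda>jk. \<mu> (snd jk)" and \<Sigma>="\<lambda>jk. \<Sigma> (snd jk)"])
    fix i jk assume "i \<in> {1..K}" "jk \<in> {1..Nc} \<times> {1..N}"
    then show "1 - \<delta> i (fst jk) (snd jk)
        \<le> measure (gaussian (\<mu> (snd jk) i) (\<Sigma> (snd jk) i)) {x. a (fst jk) \<bullet> x \<le> b (fst jk)}"
      using \<delta> by (intro gaussian_halfspace[where S="S (snd jk) i"] assms(5)) auto
  qed (use assms in auto)
  also have "{\<omega> \<in> space M. \<forall>jk\<in>{1..Nc} \<times> {1..N}. y (snd jk) \<omega> \<in> {x. a (fst jk) \<bullet> x \<le> b (fst jk)}}
      = {\<omega> \<in> space M. \<forall>j\<in>{1..Nc}. \<forall>k\<in>{1..N}. a j \<bullet> y k \<omega> - b j \<le> 0}"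
    by auto
  finally show "1 - \<Delta> \<le> prob {\<omega> \<in> space M. \<forall>j\<in>{1..Nc}. \<forall>k\<in>{1..N}. a j \<bullet> y k \<omega> - b j \<le> 0}"
    using sum by (simp add: sum.cartesian_product)
next
  interpret prob_space M by fact
  fix \<gamma> :: "nat \<Rightarrow> nat \<Rightarrow> real"
  assume \<gamma>: "\<forall>i\<in>{1..K}. \<forall>k\<in>{0..<N}. \<gamma> i k \<in> {0<..<1} \<and>
      norm (G *v \<mu> k i + g)
        + sqrt (inv_cdf (chi_square_distribution CARD('n)) (1 - \<gamma> i k)) * spectral_norm (G ** S k i)
        \<le> y_max"
    and sum: "(\<Sum>i=1..K. \<Sum>k=0..<N. \<alpha> i * \<gamma> i k) \<le> \<Gamma>"
  \<comment> \<open>There is one norm constraint per time, so the times themselves serve as index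
    set, now from 0 to \<open>N - 1\<close>.\<close>
  have "1 - (\<Sum>i=1..K. \<Sum>k=0..<N. \<alpha> i * \<gamma> i k)
      \<le> prob {\<omega> \<in> space M. \<forall>k\<in>{0..<N}. y k \<omega> \<in> {x. norm (G *v x + g) \<le> y_max}}"
  proof (rule gmm_joint_chance)
    fix i k assume "i \<in> {1..K}" "k \<in> {0..<N}"
    then show "1 - \<gamma> i k \<le> measure (gaussian (\<mu> k i) (\<Sigma> k i)) {x. norm (G *v x + g) \<le> y_max}"
      using \<gamma> by (intro gaussian_norm_affine[where S="S k i"] assms(5)) auto
  qed (use assms in auto)
  with sum show "1 - \<Gamma> \<le> prob {\<omega> \<in> space M. \<forall>k\<in>{0..<N}. norm (G *v y k \<omega> + g) \<le> y_max}"
    by simp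
qed

end
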